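(* Let $n\ge 2$, $h:=1/(n-1)$, and let $U_1,\ldots,U_n,A:\mathbb{R}_{>0}\to\mathbb{R}$ be the functions defined recursively by $$\begin{array}{rcl} U_1(u_1)&:=&u_1,\\ U_2(u_1)&:=&u_1+\frac{h^2}{2}g_1(u_1),\\ U_{k+1}(u_1)&:=&2U_k(u_1)-U_{k-1}(u_1)+h^2g_1\big(U_k(u_1)\big)\quad(2\le k\le n-1),\\ A(u_1)&:=&\Big(\frac1h\big(U_n(u_1)-U_{n-1}(u_1)\big)+\frac h2 g_1\big(U_n(u_1)\big)\Big)\Big/g_2\big(U_n(u_1)\big).\end{array}$$ If the function $g:=g_1/g_2:\mathbb{R}_{>0}\to\mathbb{R}_{>0}$ is decreasing, then $A'(u_1)<0$ for every $u_1\in\mathbb{R}_{>0}$.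
   Context: $g_1,g_2:\mathbb{R}\to\mathbb{R}$ are functions of class $\mathcal{C}^3(\mathbb{R})$ such that $g_i(0)=0$, $g_i'(x)>0$, $g_i''(x)>0$ and $g_i'''(x)\ge 0$ for all $x>0$ and $i=1,2$. *)

theory Defs
  imports "HOL-Analysis.Analysis"
begin

definition C3 :: "(real \<Rightarrow> real) \<Rightarrow> bool" where
  "C3 f \<longleftrightarrow> (\<forall>j<3. \<forall>x. (deriv ^^ j) f field_differentiable at x)
            \<and> continuous_on UNIV ((deriv ^^ 3) f)"

text \<open>
  \<open>U g1 h k u\<close> is $U_k(u)$, for mesh width \<open>h\<close>. Indices start at 1; the value at index 0 is a
  dummy that no other equation uses.
\<close>

fun U :: "(real \<Rightarrow> real) \<Rightarrow> real \<Rightarrow> nat \<Rightarrow> real \<Rightarrow> real" where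
  "U g1 h 0 u = 0"
| "U g1 h (Suc 0) u = u"
| "U g1 h (Suc (Suc 0)) u = u + h\<^sup>2 / 2 * g1 u"
| "U g1 h (Suc (Suc (Suc k))) u =
     2 * U g1 h (Suc (Suc k)) u - U g1 h (Suc k) u + h\<^sup>2 * g1 (U g1 h (Suc (Suc k)) u)"

definition mesh :: "nat \<Rightarrow> real" where
  "mesh n = 1 / (real n - 1)"

definition A :: "(real \<Rightarrow> real) \<Rightarrow> (real \<Rightarrow> real) \<Rightarrow> nat \<Rightarrow> real \<Rightarrow> real" where
  "A g1 g2 n u =
     (let h = mesh n in
       (1 / h * (U g1 h n u - U g1 h (n - 1) u) + h / 2 * g1 (U g1 h n u)) / g2 (U g1 h n u))"

end

theory Submission
  imports Defs
begin

text \<open>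
  The argument is a discrete Sturm comparison. Write $U_k$ for the iterates, $W_k = U_k'$ for their
  derivatives with respect to the initial value $u$, and $P_k = g_1(U_k)$. Differentiating the
  recursion gives the linear equation
  $W_{k+1} - 2W_k + W_{k-1} = h^2 g_1'(U_k) W_k$. Since $g_1$ lies above its tangent at $U_k$,
  the sequence $P$ is a supersolution of the same equation:
  $P_{k+1} - 2P_k + P_{k-1} \ge g_1'(U_k)(U_{k+1} - 2U_k + U_{k-1}) = h^2 g_1'(U_k) P_k$.
  Hence the discrete Wronskian $W_{k+1}P_k - W_kP_{k+1}$ is nonincreasing in $k$; it is negative
  for $k = 1$ by strict convexity, and so it is negative for all $k$
  (lemma \<open>wronskian_neg\<close>).

  Let $S = (U_n - U_{n-1})/h + (h/2) g_1(U_n)$ be the numerator of $A$. In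
  $S'P_n - S P_n'$ the two contributions of $(h/2) g_1(U_n)$ cancel, and what remains is
  $1/h$ times $(W_n - W_{n-1})P_n - (U_n - U_{n-1}) g_1'(U_n) W_n$. By the Wronskian inequality
  and the tangent inequality at $U_n$,
  $(W_n - W_{n-1})P_n < W_n(P_n - P_{n-1}) \le W_n g_1'(U_n)(U_n - U_{n-1})$,
  so $S/g_1(U_n)$ has negative derivative (lemma \<open>increment_bound\<close>).
  Finally $A = (S/g_1(U_n)) \cdot g(U_n)$, where $g = g_1/g_2$ is positive and nonincreasing, and
  $U_n$ is increasing in $u$.
\<close>

section \<open>Convexity and monotonicity on the positive half-line\<close>

lemma C3_derivs:
  assumes "C3 f"
  shows "(f has_real_derivative deriv f x) (at x)"
    and "(deriv f has_real_derivative (deriv ^^ 2) f x) (at x)"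
proof -
  have "(deriv ^^ 0) f field_differentiable at x" "(deriv ^^ 1) f field_differentiable at x"
    using assms unfolding C3_def by (metis one_less_numeral_iff semiring_norm(77) zero_less_numeral)+
  then show "(f has_real_derivative deriv f x) (at x)"
    and "(deriv f has_real_derivative (deriv ^^ 2) f x) (at x)"
    by (simp_all add: DERIV_deriv_iff_field_differentiable numeral_2_eq_2)
qed

lemma pos_of_deriv_pos:
  fixes f :: "real \<Rightarrow> real"
  assumes "\<And>x. (f has_real_derivative deriv f x) (at x)"
    and "f 0 = 0" and "\<And>x. x > 0 \<Longrightarrow> deriv f x > 0" and "x > 0"
  shows "f x > 0"
proof -
  obtain z where "0 < z" "f x - f 0 = (x - 0) * deriv f z"
    using MVT2[OF \<open>x > 0\<close>, of f "deriv f"] assms(1) by blast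
  then show ?thesis using assms by simp
qed

lemma deriv_strict_mono:
  fixes f :: "real \<Rightarrow> real"
  assumes "\<And>x. (deriv f has_real_derivative (deriv ^^ 2) f x) (at x)"
    and "\<And>x. x > 0 \<Longrightarrow> (deriv ^^ 2) f x > 0" and "0 < x" and "x < y"
  shows "deriv f x < deriv f y"
proof -
  obtain z where "x < z" "deriv f y - deriv f x = (y - x) * (deriv ^^ 2) f z"
    using MVT2[OF \<open>x < y\<close>, of "deriv f" "(deriv ^^ 2) f"] assms(1) by blast
  moreover have "(y - x) * (deriv ^^ 2) f z > 0"
    using assms(2)[of z] \<open>x < z\<close> assms(3,4) by simp
  ultimately show ?thesis by simp
qed

section \<open>The iterates and their derivatives\<close>

text \<open>
  A positive, increasing, strictly convex function \<open>f\<close> on the positive half-line, in the role of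
  $g_1$, together with a step width \<open>h\<close>. Strict convexity is encoded as strict monotonicity of
  the derivative.
\<close>
locale convex_source =
  fixes f :: "real \<Rightarrow> real" and h :: real
  assumes h_pos: "h > 0"
    and f_deriv: "x > 0 \<Longrightarrow> (f has_real_derivative deriv f x) (at x)"
    and f_pos: "x > 0 \<Longrightarrow> f x > 0"
    and f'_pos: "x > 0 \<Longrightarrow> deriv f x > 0"
    and f'_strict_mono: "0 < x \<Longrightarrow> x < y \<Longrightarrow> deriv f x < deriv f y"
begin

abbreviation V :: "nat \<Rightarrow> real \<Rightarrow> real" where "V \<equiv> U f h"

text \<open>The derivative of the \<open>k\<close>-th iterate with respect to the initial value.\<close>
abbreviation W :: "nat \<Rightarrow> real \<Rightarrow> real" where "W k u \<equiv> deriv (V k) u"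

lemma above_tangent_strict:
  assumes "x > 0" "y > 0" "x \<noteq> y"
  shows "f y > f x + deriv f x * (y - x)"
proof (cases "x < y")
  case True
  obtain z where z: "x < z" "z < y" "f y - f x = (y - x) * deriv f z"
    using MVT2[OF True, of f "deriv f"] f_deriv assms by force
  have "(y - x) * deriv f x < (y - x) * deriv f z"
    using f'_strict_mono[of x z] z assms True by simp
  then show ?thesis using z by (simp add: algebra_simps)
next
  case False
  then have "y < x" using assms by simp
  obtain z where z: "y < z" "z < x" "f x - f y = (x - y) * deriv f z"
    using MVT2[OF \<open>y < x\<close>, of f "deriv f"] f_deriv assms by force
  have "(x - y) * deriv f z < (x - y) * deriv f x"
    using f'_strict_mono[of z x] z assms \<open>y < x\<close> by simp
  then show ?thesis using z by (simp add: algebra_simps)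
qed

lemma above_tangent:
  assumes "x > 0" "y > 0"
  shows "f y \<ge> f x + deriv f x * (y - x)"
  using above_tangent_strict[OF assms] by (cases "x = y") auto

lemma iterates_pos_increasing:
  assumes "u > 0"
  shows "V (Suc k) u > 0 \<and> V (Suc k) u < V (Suc (Suc k)) u"
proof (induction k)
  case 0
  then show ?case using assms h_pos f_pos[of u] by simp
next
  case (Suc k)
  then have pos: "V (Suc (Suc k)) u > 0" by linarith
  have "h\<^sup>2 * f (V (Suc (Suc k)) u) > 0" using f_pos[OF pos] h_pos by simp
  with Suc pos show ?case by simp
qed

lemmas iterates_pos = iterates_pos_increasing[THEN conjunct1]
lemmas iterates_increasing = iterates_pos_increasing[THEN conjunct2]

lemma U_one: "V (Suc 0) = (\<lambda>u. u)"
  by (rule ext) simp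

lemma U_two: "V (Suc (Suc 0)) = (\<lambda>u. u + h\<^sup>2 / 2 * f u)"
  by (rule ext) simp

lemma U_step: "V (Suc (Suc (Suc k)))
    = (\<lambda>u. 2 * V (Suc (Suc k)) u - V (Suc k) u + h\<^sup>2 * f (V (Suc (Suc k)) u))"
  by (rule ext) simp

lemma iterates_differentiable:
  assumes "u > 0"
  shows "V (Suc k) field_differentiable at u \<and> V (Suc (Suc k)) field_differentiable at u"
proof (induction k)
  case 0
  have "((\<lambda>u. u + h\<^sup>2 / 2 * f u) has_real_derivative 1 + h\<^sup>2 / 2 * deriv f u) (at u)"
    by (rule derivative_eq_intros f_deriv[OF assms] refl | simp)+
  then show ?case unfolding U_one U_two field_differentiable_def using DERIV_ident by blast
next
  case (Suc k)
  then obtain D E where D: "(V (Suc k) has_real_derivative D) (at u)"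
    and E: "(V (Suc (Suc k)) has_real_derivative E) (at u)"
    by (auto simp: field_differentiable_def)
  have "((\<lambda>u. 2 * V (Suc (Suc k)) u - V (Suc k) u + h\<^sup>2 * f (V (Suc (Suc k)) u))
      has_real_derivative 2 * E - D + h\<^sup>2 * (deriv f (V (Suc (Suc k)) u) * E)) (at u)"
    by (rule derivative_eq_intros D E DERIV_chain2[OF f_deriv] iterates_pos assms refl | simp)+
  then show ?case
    using Suc unfolding U_step[of k] field_differentiable_def by blast
qed

lemma iterates_deriv:
  assumes "u > 0"
  shows "(V (Suc k) has_real_derivative W (Suc k) u) (at u)"
  using iterates_differentiable[OF assms, of k]
  by (simp add: DERIV_deriv_iff_field_differentiable)

lemma W_one: "W (Suc 0) u = 1"
  by (simp add: U_one)

lemma W_two: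
  assumes "u > 0"
  shows "W (Suc (Suc 0)) u = 1 + h\<^sup>2 / 2 * deriv f u"
proof -
  have "((\<lambda>u. u + h\<^sup>2 / 2 * f u) has_real_derivative 1 + h\<^sup>2 / 2 * deriv f u) (at u)"
    by (rule derivative_eq_intros f_deriv[OF assms] refl | simp)+
  then show ?thesis unfolding U_two by (rule DERIV_imp_deriv)
qed

lemma W_step:
  assumes "u > 0"
  shows "W (Suc (Suc (Suc k))) u = 2 * W (Suc (Suc k)) u - W (Suc k) u
    + h\<^sup>2 * (deriv f (V (Suc (Suc k)) u) * W (Suc (Suc k)) u)"
proof -
  have "((\<lambda>u. 2 * V (Suc (Suc k)) u - V (Suc k) u + h\<^sup>2 * f (V (Suc (Suc k)) u))
      has_real_derivative 2 * W (Suc (Suc k)) u - W (Suc k) u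
        + h\<^sup>2 * (deriv f (V (Suc (Suc k)) u) * W (Suc (Suc k)) u)) (at u)"
    by (rule derivative_eq_intros iterates_deriv DERIV_chain2[OF f_deriv] iterates_pos assms refl
        | simp)+
  then show ?thesis unfolding U_step[of k] by (rule DERIV_imp_deriv)
qed

lemma W_pos_increasing:
  assumes "u > 0"
  shows "W (Suc k) u > 0 \<and> W (Suc k) u \<le> W (Suc (Suc k)) u"
proof (induction k)
  case 0
  then show ?case unfolding W_one W_two[OF assms] using f'_pos[OF assms] by simp
next
  case (Suc k)
  then have pos: "W (Suc (Suc k)) u > 0" by linarith
  have "h\<^sup>2 * (deriv f (V (Suc (Suc k)) u) * W (Suc (Suc k)) u) > 0"
    using f'_pos[OF iterates_pos[OF assms, of "Suc k"]] h_pos pos by simp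
  with Suc pos W_step[OF assms, of k] show ?case by linarith
qed

lemmas W_pos = W_pos_increasing[THEN conjunct1]

section \<open>The discrete Wronskian\<close>

lemma wronskian_neg:
  assumes "u > 0"
  shows "W (Suc (Suc k)) u * f (V (Suc k) u) < W (Suc k) u * f (V (Suc (Suc k)) u)"
proof (induction k)
  case 0
  have "f (V (Suc (Suc 0)) u) > f u + deriv f u * (h\<^sup>2 / 2 * f u)"
    using above_tangent_strict[of u "V (Suc (Suc 0)) u"] assms h_pos f_pos[OF assms]
    by (simp add: add_pos_pos)
  then show ?case by (simp only: W_one W_two[OF assms]) (simp add: algebra_simps)
next
  case (Suc k)
  define x y z where "x = V (Suc k) u" "y = V (Suc (Suc k)) u" "z = V (Suc (Suc (Suc k))) u"
  define a b c where "a = W (Suc k) u" "b = W (Suc (Suc k)) u" "c = W (Suc (Suc (Suc k))) u"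
  have pos: "x > 0" "y > 0" "z > 0" "b > 0"
    unfolding x_y_z_def a_b_c_def using iterates_pos W_pos assms by blast+
  have z: "z = 2 * y - x + h\<^sup>2 * f y"
    by (simp add: x_y_z_def)
  have c: "c = 2 * b - a + h\<^sup>2 * (deriv f y * b)"
    unfolding x_y_z_def a_b_c_def by (rule W_step[OF assms])
  \<comment> \<open>The sequence \<open>f \<circ> V\<close> is a supersolution of the linear recursion satisfied by \<open>W\<close>.\<close>
  have "f x + f z \<ge> 2 * f y + deriv f y * ((x - y) + (z - y))"
    unfolding distrib_left using above_tangent[of y x] above_tangent[of y z] pos by linarith
  then have "f x + f z \<ge> 2 * f y + deriv f y * (h\<^sup>2 * f y)"
    by (simp add: z)
  then have "b * (2 * f y + deriv f y * (h\<^sup>2 * f y)) \<le> b * (f x + f z)"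
    using pos by (intro mult_left_mono) auto
  moreover have "b * (2 * f y + deriv f y * (h\<^sup>2 * f y)) = (a + c) * f y"
    by (simp add: c algebra_simps)
  moreover have "b * f x < a * f y"
    using Suc by (simp add: x_y_z_def a_b_c_def)
  ultimately have "c * f y < b * f z" by (simp add: algebra_simps)
  then show ?case unfolding x_y_z_def a_b_c_def .
qed

text \<open>
  The logarithmic derivative of $U_{k+2} - U_{k+1}$ with respect to $u$ is smaller than that of
  $f(U_{k+2})$.
\<close>
lemma increment_bound:
  assumes "u > 0"
  shows "(W (Suc (Suc k)) u - W (Suc k) u) * f (V (Suc (Suc k)) u)
    < (V (Suc (Suc k)) u - V (Suc k) u) * (deriv f (V (Suc (Suc k)) u) * W (Suc (Suc k)) u)"
proof -
  define x y where "x = V (Suc k) u" "y = V (Suc (Suc k)) u"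
  define a b where "a = W (Suc k) u" "b = W (Suc (Suc k)) u"
  have pos: "x > 0" "y > 0" "b > 0"
    unfolding x_y_def a_b_def using iterates_pos W_pos assms by blast+
  have "b * f x < a * f y"
    unfolding x_y_def a_b_def by (rule wronskian_neg[OF assms])
  then have "(b - a) * f y < b * (f y - f x)" by (simp add: algebra_simps)
  also have "\<dots> \<le> b * (deriv f y * (y - x))"
    using above_tangent[of y x] pos by (intro mult_left_mono) (auto simp: algebra_simps)
  finally show ?thesis by (simp add: x_y_def a_b_def mult_ac)
qed

end

section \<open>The quotient\<close>

lemma antimono_quotient_deriv:
  fixes g1 g2 :: "real \<Rightarrow> real"
  assumes "antimono_on {0<..} (\<lambda>x. g1 x / g2 x)" and "x > 0"
    and "(g1 has_real_derivative D1) (at x)" and "(g2 has_real_derivative D2) (at x)"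
    and "g2 x > 0"
  shows "D1 * g2 x \<le> g1 x * D2"
proof -
  have "mono_on {0<..} (\<lambda>x. - (g1 x / g2 x))"
    using assms(1) by (auto simp: monotone_on_def)
  moreover have "((\<lambda>x. - (g1 x / g2 x)) has_real_derivative
      - ((D1 * g2 x - g1 x * D2) / (g2 x * g2 x))) (at x)"
    using assms by (intro DERIV_minus DERIV_divide) auto
  moreover have "x \<in> interior {0<..}"
    using assms(2) by (simp add: interior_open)
  ultimately have "- ((D1 * g2 x - g1 x * D2) / (g2 x * g2 x)) \<ge> 0"
    by (rule mono_on_imp_deriv_nonneg)
  then show ?thesis using assms(5) by (simp add: divide_le_0_iff mult_le_0_iff)
qed

theorem theorem5:
  fixes g1 g2 :: "real \<Rightarrow> real" and n :: nat
  assumes "C3 g1" and "C3 g2"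
    and "g1 0 = 0" and "g2 0 = 0"
    and "\<And>x. x > 0 \<Longrightarrow> deriv g1 x > 0" and "\<And>x. x > 0 \<Longrightarrow> deriv g2 x > 0"
    and "\<And>x. x > 0 \<Longrightarrow> (deriv ^^ 2) g1 x > 0" and "\<And>x. x > 0 \<Longrightarrow> (deriv ^^ 2) g2 x > 0"
    and "\<And>x. x > 0 \<Longrightarrow> (deriv ^^ 3) g1 x \<ge> 0" and "\<And>x. x > 0 \<Longrightarrow> (deriv ^^ 3) g2 x \<ge> 0"
    and "n \<ge> 2"
    and "antimono_on {0<..} (\<lambda>x. g1 x / g2 x)"
  shows "\<forall>u>0. A g1 g2 n field_differentiable at u \<and> deriv (A g1 g2 n) u < 0"
proof (intro allI impI)
  fix u :: real
  assume u: "u > 0"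
  define h where "h = mesh n"
  have h: "h > 0" using \<open>n \<ge> 2\<close> by (simp add: h_def mesh_def)
  note d1 = C3_derivs[OF \<open>C3 g1\<close>] and d2 = C3_derivs[OF \<open>C3 g2\<close>]
  have g1_pos: "g1 x > 0" if "x > 0" for x
    using d1(1) \<open>g1 0 = 0\<close> assms(5) that by (rule pos_of_deriv_pos)
  have g2_pos: "g2 x > 0" if "x > 0" for x
    using d2(1) \<open>g2 0 = 0\<close> assms(6) that by (rule pos_of_deriv_pos)
  interpret convex_source g1 h
    by unfold_locales (use h d1 g1_pos assms(5) deriv_strict_mono[OF d1(2) assms(7)] in auto)
  obtain k where n: "n = Suc (Suc k)"
    using \<open>n \<ge> 2\<close> by (metis add_2_eq_Suc le_Suc_ex)
  define x y where "x = V (n - 1) u" "y = V n u"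
  define a b where "a = W (n - 1) u" "b = W n u"
  have a: "(V (n - 1) has_real_derivative a) (at u)" and b: "(V n has_real_derivative b) (at u)"
    using iterates_deriv[OF u] by (simp_all add: a_b_def n)
  have pos: "y > 0" "b > 0" "x < y"
    using iterates_pos[OF u] W_pos[OF u] iterates_increasing[OF u]
    by (simp_all add: x_y_def a_b_def n del: U.simps)
  define S where "S = 1 / h * (y - x) + h / 2 * g1 y"
  define S' where "S' = 1 / h * (b - a) + h / 2 * (deriv g1 y * b)"
  have S_pos: "S > 0" using pos h g1_pos by (simp add: S_def add_pos_pos)
  have "((\<lambda>u. 1 / h * (V n u - V (n - 1) u) + h / 2 * g1 (V n u)) has_real_derivative S') (at u)"
    unfolding S'_def x_y_def by (rule derivative_eq_intros DERIV_chain2[OF d1(1)] a b refl | simp)+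
  moreover have "((\<lambda>u. g2 (V n u)) has_real_derivative deriv g2 y * b) (at u)"
    unfolding x_y_def by (rule DERIV_chain2[OF d2(1) b])
  ultimately have dA: "(A g1 g2 n has_real_derivative
      (S' * g2 y - S * (deriv g2 y * b)) / (g2 y * g2 y)) (at u)"
    using DERIV_divide g2_pos[OF \<open>y > 0\<close>]
    unfolding A_def Let_def h_def[symmetric] S_def x_y_def by fastforce
  \<comment> \<open>The terms of \<open>S'\<close> and \<open>S\<close> with factor \<open>h / 2\<close> contribute equally to both sides of
    \<open>S' * g1 y < S * (deriv g1 y * b)\<close>, so the bound on the increment suffices.\<close>
  have "(b - a) * g1 y < (y - x) * (deriv g1 y * b)"
    using increment_bound[OF u, of k] by (simp add: x_y_def a_b_def n del: U.simps)
  then have "1 / h * ((b - a) * g1 y) < 1 / h * ((y - x) * (deriv g1 y * b))"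
    using h by (intro mult_strict_left_mono) auto
  then have "S' * g1 y < S * (deriv g1 y * b)"
    by (simp add: S_def S'_def algebra_simps diff_divide_distrib)
  then have "S' * g1 y * g2 y < S * (deriv g1 y * b) * g2 y"
    using g2_pos[OF \<open>y > 0\<close>] by simp
  also have "\<dots> = (S * b) * (deriv g1 y * g2 y)" by (simp add: mult_ac)
  also have "\<dots> \<le> (S * b) * (g1 y * deriv g2 y)"
    using antimono_quotient_deriv[OF assms(12) \<open>y > 0\<close> d1(1) d2(1) g2_pos] pos S_pos
    by (intro mult_left_mono) auto
  finally have "g1 y * (S' * g2 y) < g1 y * (S * (deriv g2 y * b))" by (simp add: mult_ac)
  then have "S' * g2 y < S * (deriv g2 y * b)"
    using g1_pos[OF \<open>y > 0\<close>] by simp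
  then have "(S' * g2 y - S * (deriv g2 y * b)) / (g2 y * g2 y) < 0"
    using g2_pos[OF \<open>y > 0\<close>] by (simp add: divide_less_0_iff)
  with dA show "A g1 g2 n field_differentiable at u \<and> deriv (A g1 g2 n) u < 0"
    by (auto simp: field_differentiable_def DERIV_imp_deriv)
qed

end
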